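(* Let $G$ be a finite Abelian group with neutral element $e$, let $k$ be a positive integer, and let $A$ be a unital complex Banach algebra equipped with a $G$-graded structure $A=\bigoplus_{g\in G}A_g$. Assume $A$ has no nontrivial idempotent. Let $a\in A_g$ for some $g\neq e$ (a nontrivial homogeneous element). Then $0$ belongs to the convex hull of the spectrum $\mathrm{sp}(a^k)$. Moreover, if $A$ is commutative and $a$ is invertible, then $a^k$ does not lie in the connected component of the identity in the group of invertible elements of $A$.
   Context: A $G$-graded structure on a unital complex Banach algebra $A$ (for a finite group $G$) is a direct sum decomposition $A=\bigoplus_{g\in G}A_g$ of $A$ into closed linear subspaces $A_g$ such that $A_gA_h\subseteq A_{gh}$ for all $g,h\in G$. An element of some $A_g$ is homogeneous; it is nontrivial homogeneous if $g\neq e$. A nontrivial idempotent is an element $p$ with $p^2=p$, $p\neq 0,1$. For $x\in A$, $\mathrm{sp}(x)$ is the set of $\lambda\in\mathbb{C}$ such that $x-\lambda 1$ is not invertible. *)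

theory Defs
  imports "HOL-Analysis.Analysis"
begin

text \<open>A unital complex Banach algebra: a real unital Banach algebra (norm 1 = 1,
submultiplicative, complete) together with a complex scalar multiplication extending
the real one, making it a complex algebra with absolutely homogeneous norm.\<close>

definition complex_scaling :: "(complex \<Rightarrow> 'a::{real_normed_algebra_1,banach} \<Rightarrow> 'a) \<Rightarrow> bool" where
  "complex_scaling smul \<longleftrightarrow>
     (\<forall>c x y. smul c (x + y) = smul c x + smul c y) \<and>
     (\<forall>c d x. smul (c + d) x = smul c x + smul d x) \<and>
     (\<forall>c d x. smul (c * d) x = smul c (smul d x)) \<and>
     (\<forall>r x. smul (complex_of_real r) x = r *\<^sub>R x) \<and>
     (\<forall>c x y. smul c (x * y) = smul c x * y \<and> smul c (x * y) = x * smul c y) \<and>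
     (\<forall>c x. norm (smul c x) = cmod c * norm x)"

definition invertible_el :: "'a::ring_1 \<Rightarrow> bool" where
  "invertible_el x \<longleftrightarrow> (\<exists>y. x * y = 1 \<and> y * x = 1)"

definition spec :: "(complex \<Rightarrow> 'a::{real_normed_algebra_1,banach} \<Rightarrow> 'a) \<Rightarrow> 'a \<Rightarrow> complex set" where
  "spec smul x = {c. \<not> invertible_el (x - smul c 1)}"

definition graded :: "(complex \<Rightarrow> 'a::{real_normed_algebra_1,banach} \<Rightarrow> 'a) \<Rightarrow> ('g::{finite,ab_group_add} \<Rightarrow> 'a set) \<Rightarrow> bool" where
  "graded smul Ag \<longleftrightarrow>
     (\<forall>g. 0 \<in> Ag g \<and> (\<forall>x\<in>Ag g. \<forall>y\<in>Ag g. x + y \<in> Ag g) \<and>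
          (\<forall>c. \<forall>x\<in>Ag g. smul c x \<in> Ag g) \<and> closed (Ag g)) \<and>
     (\<forall>g h. \<forall>x\<in>Ag g. \<forall>y\<in>Ag h. x * y \<in> Ag (g + h)) \<and>
     (\<forall>x. \<exists>!f. (\<forall>g. f g \<in> Ag g) \<and> x = (\<Sum>g\<in>UNIV. f g))"

definition no_nontrivial_idempotent :: "'a::ring_1 itself \<Rightarrow> bool" where
  "no_nontrivial_idempotent _ \<longleftrightarrow> (\<forall>p::'a. p * p = p \<longrightarrow> p = 0 \<or> p = 1)"

end

theory Submission
  imports Defs
begin

text \<open>
  A character \<open>\<phi>\<close> of the grading group with \<open>\<phi> g \<noteq> 1\<close> acts on the algebra by an automorphism \<open>T\<close>
  that multiplies the \<open>h\<close>-component by \<open>\<phi> h\<close> and satisfies \<open>T ^ m = id\<close> for some \<open>m > 0\<close>. If 0 is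
  not in the convex hull of the spectrum of \<open>a ^ k\<close>, or if \<open>a ^ k\<close> lies in the identity component of
  a commutative algebra, then \<open>a ^ k\<close> can be joined to a nonzero scalar through commuting invertible
  elements, and therefore has roots \<open>d\<close> of every order that commute with its commutant. Without
  nontrivial idempotents, an element some power of which is a nonzero scalar is itself a scalar.
  Taking \<open>d\<close> of order \<open>k * m\<close>, one obtains \<open>a = r d ^ m\<close> and then \<open>T d = c d\<close> with scalars \<open>r\<close>, \<open>c\<close>.
  Since \<open>T a = \<phi> g a\<close>, it follows that \<open>c ^ m = \<phi> g\<close>, whereas \<open>T ^ m = id\<close> gives \<open>c ^ m = 1\<close>.
\<close>

section \<open>Roots along connected sets of invertible elements\<close>

lemma abs_gbinomial_le_1:
  fixes c :: real
  assumes "0 \<le> c" "c \<le> 1"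
  shows "\<bar>c gchoose j\<bar> \<le> 1"
proof (induction j)
  case (Suc j)
  \<comment> \<open>Consecutive coefficients differ by the factor \<open>(c - j) / (j + 1)\<close>,
    of absolute value at most 1 for \<open>c\<close> in [0, 1].\<close>
  have "(c gchoose j) * (c - real j) = real (Suc j) * (c gchoose Suc j)"
    using gbinomial_mult_1'[of c j] by (simp add: algebra_simps)
  then have "real (Suc j) * \<bar>c gchoose Suc j\<bar> = \<bar>c gchoose j\<bar> * \<bar>c - real j\<bar>"
    by (metis abs_mult abs_of_nat)
  also have "\<dots> \<le> 1 * real (Suc j)"
    using Suc assms by (intro mult_mono) auto
  finally have "real (Suc j) * \<bar>c gchoose Suc j\<bar> \<le> real (Suc j) * 1"
    by simp
  then show ?case
    by (subst (asm) mult_le_cancel_left_pos) auto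
qed simp

text \<open>Newton's series for the power \<open>(1 + y)\<close> to the exponent \<open>c\<close>.
  Coefficients bounded by 1 let the geometric series dominate it when
  \<open>norm y < 1\<close>.\<close>

definition binomial_series :: "real \<Rightarrow> 'a::{real_normed_algebra_1,banach} \<Rightarrow> 'a" where
  "binomial_series c y = (\<Sum>j. (c gchoose j) *\<^sub>R y ^ j)"

context
  fixes y :: "'a::{real_normed_algebra_1,banach}"
  assumes y: "norm y < 1"
begin

lemma summable_norm_binomial_series:
  assumes "0 \<le> c" "c \<le> 1"
  shows "summable (\<lambda>j. norm ((c gchoose j) *\<^sub>R y ^ j))"
proof (rule summable_comparison_test')
  show "summable (\<lambda>j. norm y ^ j)"
    using y by simp
  fix j :: nat
  have "\<bar>c gchoose j\<bar> * norm (y ^ j) \<le> 1 * norm y ^ j"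
    using abs_gbinomial_le_1[OF assms] by (intro mult_mono norm_power_ineq) auto
  then show "norm (norm ((c gchoose j) *\<^sub>R y ^ j)) \<le> norm y ^ j"
    by simp
qed

lemma summable_binomial_series:
  assumes "0 \<le> c" "c \<le> 1"
  shows "summable (\<lambda>j. (c gchoose j) *\<^sub>R y ^ j)"
  by (rule summable_norm_cancel[OF summable_norm_binomial_series[OF assms]])

text \<open>The exponents add because the coefficients of the Cauchy product are evaluated by
  Vandermonde's identity.\<close>

lemma binomial_series_add:
  assumes "0 \<le> c" "0 \<le> d" "c + d \<le> 1"
  shows "binomial_series c y * binomial_series d y = binomial_series (c + d) y"
proof -
  have "binomial_series c y * binomial_series d y
      = (\<Sum>n. \<Sum>i\<le>n. ((c gchoose i) *\<^sub>R y ^ i) * ((d gchoose (n - i)) *\<^sub>R y ^ (n - i)))"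
    unfolding binomial_series_def using assms
    by (intro Cauchy_product summable_norm_binomial_series) auto
  also have "(\<lambda>n. \<Sum>i\<le>n. ((c gchoose i) *\<^sub>R y ^ i) * ((d gchoose (n - i)) *\<^sub>R y ^ (n - i)))
      = (\<lambda>n. ((c + d) gchoose n) *\<^sub>R y ^ n)"
  proof
    fix n
    have "(\<Sum>i\<le>n. ((c gchoose i) *\<^sub>R y ^ i) * ((d gchoose (n - i)) *\<^sub>R y ^ (n - i)))
        = (\<Sum>i\<le>n. ((c gchoose i) * (d gchoose (n - i))) *\<^sub>R y ^ n)"
      by (intro sum.cong) (auto simp: mult.commute simp flip: power_add)
    also have "\<dots> = ((c + d) gchoose n) *\<^sub>R y ^ n"
      by (simp only: scaleR_sum_left[symmetric] gbinomial_Vandermonde atMost_atLeast0)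
    finally show "(\<Sum>i\<le>n. ((c gchoose i) *\<^sub>R y ^ i) * ((d gchoose (n - i)) *\<^sub>R y ^ (n - i)))
        = ((c + d) gchoose n) *\<^sub>R y ^ n" .
  qed
  finally show ?thesis
    by (simp add: binomial_series_def)
qed

lemma binomial_series_0: "binomial_series 0 y = 1"
proof -
  have "binomial_series 0 y = (\<Sum>j\<in>{0}. ((0::real) gchoose j) *\<^sub>R y ^ j)"
    unfolding binomial_series_def by (intro suminf_finite) (auto simp: gbinomial_0_left)
  then show ?thesis
    by simp
qed

lemma binomial_series_1: "binomial_series 1 y = 1 + y"
proof -
  have "((1::real) gchoose j) = of_nat (1 choose j)" for j
    by (metis binomial_gbinomial of_nat_1)
  then have "binomial_series 1 y = (\<Sum>j\<in>{0,1}. ((1::real) gchoose j) *\<^sub>R y ^ j)"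
    unfolding binomial_series_def
    by (intro suminf_finite) (auto simp: binomial_eq_0_iff)
  then show ?thesis
    by simp
qed

lemma binomial_series_root:
  assumes "N > 0"
  shows "binomial_series (1 / real N) y ^ N = 1 + y"
proof -
  \<comment> \<open>The restriction to \<open>i \<le> N\<close> keeps every sum of exponents at most
    1, as \<open>binomial_series_add\<close> requires.\<close>
  have "i \<le> N \<Longrightarrow> binomial_series (1 / real N) y ^ i = binomial_series (real i / real N) y" for i
  proof (induction i)
    case 0
    then show ?case by (simp add: binomial_series_0)
  next
    case (Suc i)
    then have "binomial_series (1 / real N) y ^ Suc i
        = binomial_series (1 / real N + real i / real N) y"
      using assms by (simp add: binomial_series_add field_simps)
    then show ?case
      by (simp add: add_divide_distrib)
  qed
  from this[of N] show ?thesis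
    using assms by (simp add: binomial_series_1)
qed

lemma binomial_series_commute:
  assumes "z * y = y * z" "0 \<le> c" "c \<le> 1"
  shows "z * binomial_series c y = binomial_series c y * z"
proof -
  have "z * y ^ j = y ^ j * z" for j
    by (simp add: assms(1) power_commuting_commutes)
  then show ?thesis
    unfolding binomial_series_def
    by (simp add: suminf_mult[symmetric] suminf_mult2 summable_binomial_series assms)
qed

end

section \<open>Invertible elements and their powers\<close>

lemma invertible_el_mult:
  fixes x y :: "'a::ring_1"
  assumes "invertible_el x" "invertible_el y"
  shows "invertible_el (x * y)"
proof -
  obtain x' y' where "x * x' = 1" "x' * x = 1" "y * y' = 1" "y' * y = 1"
    using assms unfolding invertible_el_def by blast
  then have "x * (y * y') * x' = 1" "y' * (x' * x) * y = 1"
    by simp_all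
  then have "(x * y) * (y' * x') = 1" "(y' * x') * (x * y) = 1"
    by (simp_all only: mult.assoc)
  then show ?thesis
    unfolding invertible_el_def by blast
qed

text \<open>Splitting one factor \<open>x\<close> off the left or the right of \<open>x ^ n\<close>
  gives a right and a left inverse of \<open>x\<close>, and these two coincide by
  associativity.\<close>

lemma invertible_el_power_iff:
  fixes x :: "'a::ring_1"
  assumes "n > 0"
  shows "invertible_el (x ^ n) \<longleftrightarrow> invertible_el x"
proof
  assume "invertible_el (x ^ n)"
  then obtain y where y: "x ^ n * y = 1" "y * x ^ n = 1"
    unfolding invertible_el_def by blast
  obtain m where n: "n = Suc m"
    using assms by (cases n) auto
  have r: "x * (x ^ m * y) = 1"
    using y(1) by (simp add: n mult.assoc)
  have l: "(y * x ^ m) * x = 1"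
    using y(2) by (simp add: n mult.assoc power_commutes)
  have "y * x ^ m = y * x ^ m * (x * (x ^ m * y))"
    by (simp add: r)
  also have "\<dots> = x ^ m * y"
    using l by (simp flip: mult.assoc)
  finally have "y * x ^ m = x ^ m * y" .
  then show "invertible_el x"
    unfolding invertible_el_def using r l by metis
next
  assume "invertible_el x"
  then show "invertible_el (x ^ n)"
  proof (induction n)
    case 0
    show ?case by (auto simp: invertible_el_def)
  qed (simp add: invertible_el_mult)
qed

lemma commute_inverse:
  fixes x y z :: "'a::ring_1"
  assumes "x * y = 1" "y * x = 1" "x * z = z * x"
  shows "y * z = z * y"
proof -
  have "y * z = y * (z * x) * y"
    by (simp add: assms(1) mult.assoc)
  also have "\<dots> = (y * x) * z * y"
    by (simp add: assms(3)[symmetric] mult.assoc)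
  finally show ?thesis
    by (simp add: assms(2))
qed

lemma power_mult_distrib_commute:
  fixes x y :: "'a::monoid_mult"
  assumes "x * y = y * x"
  shows "(x * y) ^ n = x ^ n * y ^ n"
proof (induction n)
  case (Suc n)
  have "y * x ^ n = x ^ n * y"
    by (rule power_commuting_commutes[symmetric]) (rule assms)
  then have "x * (y * (x ^ n * y ^ n)) = x * (x ^ n * (y * y ^ n))"
    by (metis mult.assoc)
  then show ?case
    by (simp add: Suc mult.assoc)
qed simp

text \<open>Commuting with \<open>W\<close> is part of the notion for two reasons: roots of
  different elements can then be multiplied, and later the root of \<open>a ^ k\<close> commutes
  with everything that commutes with \<open>a ^ k\<close>.\<close>

definition commuting_root :: "nat \<Rightarrow> 'a::monoid_mult set \<Rightarrow> 'a \<Rightarrow> bool" where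
  "commuting_root N W x \<longleftrightarrow> (\<exists>d. d ^ N = x \<and> (\<forall>z\<in>W. z * d = d * z))"

text \<open>Membership of \<open>d\<close> in \<open>W\<close> makes it commute with the given root
  of \<open>x\<close>, so the product of the two roots is a root of the product.\<close>

lemma commuting_root_mult:
  assumes "commuting_root N W x" "d ^ N = y" "d \<in> W" "\<forall>z\<in>W. z * d = d * z"
  shows "commuting_root N W (x * y)"
proof -
  obtain e where e: "e ^ N = x" "\<forall>z\<in>W. z * e = e * z"
    using assms(1) unfolding commuting_root_def by blast
  have "(e * d) ^ N = x * y"
    using e assms by (simp add: power_mult_distrib_commute)
  moreover have "z * (e * d) = (e * d) * z" if "z \<in> W" for z
  proof -
    have "z * (e * d) = e * (z * d)"
      using e(2) that by (simp flip: mult.assoc)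
    then show ?thesis
      using assms(4) that by (simp add: mult.assoc)
  qed
  ultimately show ?thesis
    unfolding commuting_root_def by blast
qed

text \<open>Nearby points of \<open>C\<close> differ by a factor \<open>1 + y\<close> with small \<open>y\<close>, which the binomial
  series equips with a root; so having a root is a locally constant property on \<open>C\<close>.\<close>

lemma commuting_root_connected:
  fixes C :: "'a::{real_normed_algebra_1,banach} set"
  assumes "connected C" and inv: "\<And>c. c \<in> C \<Longrightarrow> invertible_el c"
    and comm: "\<And>c c'. c \<in> C \<Longrightarrow> c' \<in> C \<Longrightarrow> c * c' = c' * c"
    and "N > 0" "p \<in> C" "q \<in> C"
    and W: "W = {z. \<forall>c\<in>C. z * c = c * z}"
    and p: "commuting_root N W p"
  shows "commuting_root N W q"
proof -
  have local_const: "\<exists>e>0. \<forall>c'\<in>C. dist c' c < e \<longrightarrow>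
      (commuting_root N W c' \<longleftrightarrow> commuting_root N W c)" if c: "c \<in> C" for c
  proof -
    obtain i where i: "c * i = 1" "i * c = 1"
      using inv[OF c] unfolding invertible_el_def by blast
    then have "i \<noteq> 0" by auto
    \<comment> \<open>The radius \<open>1 / norm i\<close> is what makes
      \<open>y = i * (c' - c)\<close> have norm below 1.\<close>
    have "commuting_root N W c' \<longleftrightarrow> commuting_root N W c"
      if c': "c' \<in> C" and d: "dist c' c < 1 / norm i" for c'
    proof -
      define y where "y = i * (c' - c)"
      have "norm y \<le> norm i * norm (c' - c)"
        unfolding y_def by (rule norm_mult_ineq)
      also have "\<dots> < 1"
        using d \<open>i \<noteq> 0\<close> by (simp add: dist_norm field_simps)
      finally have y: "norm y < 1" .
      have c'y: "c' = c * (1 + y)"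
        using i by (simp add: y_def distrib_left right_diff_distrib flip: mult.assoc)
      have yW: "z * y = y * z" if "z \<in> W" for z
      proof -
        have "z * c = c * z" "z * c' = c' * z"
          using that W c c' by auto
        moreover have "z * i = i * z"
          using commute_inverse[OF i] \<open>z * c = c * z\<close> by simp
        ultimately have "z * i * (c' - c) = i * ((c' - c) * z)"
          by (simp add: mult.assoc left_diff_distrib right_diff_distrib)
        then show ?thesis
          by (simp add: y_def mult.assoc)
      qed
      define b where "b = binomial_series (1 / real N) y"
      have bN: "b ^ N = 1 + y"
        unfolding b_def by (rule binomial_series_root[OF y \<open>N > 0\<close>])
      have bW: "z * b = b * z" if "z \<in> W" for z
        unfolding b_def using \<open>N > 0\<close> yW[OF that]
        by (intro binomial_series_commute[OF y]) auto
      \<comment> \<open>Since \<open>C\<close> is commutative, it lies in its commutant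
        \<open>W\<close>. Whatever commutes with all of \<open>W\<close> therefore commutes with
        \<open>C\<close> and belongs to \<open>W\<close>; this applies to \<open>b\<close> and to
        its inverse \<open>b'\<close>.\<close>
      have CW: "C \<subseteq> W"
        using comm W by auto
      then have "b \<in> W"
        using bW W by (simp add: subset_iff)
      have "invertible_el (1 + y)"
      proof -
        have "1 + y = i * c'"
          using i by (simp add: y_def right_diff_distrib)
        moreover have "invertible_el i"
          using i unfolding invertible_el_def by blast
        ultimately show ?thesis
          using inv[OF c'] by (simp add: invertible_el_mult)
      qed
      then have "invertible_el b"
        using invertible_el_power_iff[OF \<open>N > 0\<close>] bN by metis
      then obtain b' where b': "b * b' = 1" "b' * b = 1"
        unfolding invertible_el_def by blast
      have b'W: "z * b' = b' * z" if "z \<in> W" for z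
        using commute_inverse[OF b'] bW[OF that] by simp
      then have "b' \<in> W"
        using CW W by (simp add: subset_iff)
      have "b ^ N * b' ^ N = 1"
        using b' by (simp flip: power_mult_distrib_commute)
      \<comment> \<open>Roots pass from \<open>c\<close> to \<open>c'\<close> by multiplication with
        \<open>b\<close>, and back by multiplication with \<open>b'\<close>.\<close>
      then have cy: "c = c' * b' ^ N"
        by (simp add: c'y mult.assoc bN)
      show ?thesis
      proof
        assume "commuting_root N W c'"
        from commuting_root_mult[OF this refl \<open>b' \<in> W\<close>] show "commuting_root N W c"
          using b'W cy by simp
      next
        assume "commuting_root N W c"
        from commuting_root_mult[OF this bN \<open>b \<in> W\<close>] show "commuting_root N W c'"
          using bW c'y by simp
      qed
    qed
    then show ?thesis
      using \<open>i \<noteq> 0\<close> by (intro exI[of _ "1 / norm i"]) auto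
  qed
  show ?thesis
  proof (rule connected_induction_simple[OF \<open>connected C\<close>, of p q "commuting_root N W"])
    fix c assume "c \<in> C"
    then obtain e where e: "e > 0"
      "\<forall>c'\<in>C. dist c' c < e \<longrightarrow> (commuting_root N W c' \<longleftrightarrow> commuting_root N W c)"
      using local_const by blast
    then have "commuting_root N W c' \<longleftrightarrow> commuting_root N W c" if "c' \<in> C \<inter> ball c e" for c'
      using that by (simp add: dist_commute)
    moreover have "openin (top_of_set C) (C \<inter> ball c e)"
      by (simp add: openin_open_Int)
    moreover have "c \<in> C \<inter> ball c e"
      using e(1) \<open>c \<in> C\<close> by simp
    ultimately show "\<exists>T. openin (top_of_set C) T \<and> c \<in> T \<and>
        (\<forall>x\<in>T. \<forall>y\<in>T. commuting_root N W x \<longrightarrow> commuting_root N W y)"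
      by blast
  qed (fact assms)+
qed

section \<open>Characters of finite abelian groups\<close>

definition nat_mult :: "nat \<Rightarrow> 'g::ab_group_add \<Rightarrow> 'g" where
  "nat_mult n x = (\<Sum>i<n. x)"

lemma nat_mult_0 [simp]: "nat_mult 0 x = 0"
  and nat_mult_Suc [simp]: "nat_mult (Suc n) x = x + nat_mult n x"
  by (simp_all add: nat_mult_def add.commute)

lemma nat_mult_add: "nat_mult (m + n) x = nat_mult m x + nat_mult n x"
  by (induction m) (simp_all add: add.assoc)

lemma nat_mult_mult: "nat_mult (m * n) x = nat_mult m (nat_mult n x)"
  by (induction m) (simp_all add: nat_mult_add)

text \<open>By the pigeonhole principle two multiples of \<open>x\<close> coincide, and the
  difference of their indices annihilates \<open>x\<close>.\<close>

lemma finite_order_element: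
  fixes x :: "'g::{finite,ab_group_add}"
  obtains n where "n > 0" "nat_mult n x = 0"
proof -
  have "\<not> inj (\<lambda>n. nat_mult n x)"
    by (meson finite finite_imageD finite_subset infinite_UNIV_nat subset_UNIV)
  then obtain i j where ij: "i < j" "nat_mult i x = nat_mult j x"
    by (metis injI linorder_neqE_nat)
  then have "nat_mult (i + (j - i)) x = nat_mult i x"
    by simp
  then have "nat_mult (j - i) x = 0"
    by (simp only: nat_mult_add) simp
  then show ?thesis
    using that[of "j - i"] ij by simp
qed

text \<open>Closure under negation is automatic, because the ambient group is finite.\<close>

definition subgroup_character :: "'g::ab_group_add set \<Rightarrow> ('g \<Rightarrow> complex) \<Rightarrow> bool" where
  "subgroup_character H \<phi> \<longleftrightarrow> 0 \<in> H \<and> (\<forall>x\<in>H. \<forall>y\<in>H. x + y \<in> H) \<and>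
     \<phi> 0 = 1 \<and> (\<forall>x\<in>H. \<forall>y\<in>H. \<phi> (x + y) = \<phi> x * \<phi> y)"

lemma subgroup_character_nat_mult:
  assumes "subgroup_character H \<phi>" "x \<in> H"
  shows "nat_mult n x \<in> H \<and> \<phi> (nat_mult n x) = \<phi> x ^ n"
  using assms by (induction n) (auto simp: subgroup_character_def)

lemma subgroup_character_minus:
  fixes x :: "'g::{finite,ab_group_add}"
  assumes "subgroup_character H \<phi>" "x \<in> H"
  shows "- x \<in> H"
proof -
  obtain n where n: "n > 0" "nat_mult n x = 0"
    by (rule finite_order_element)
  then obtain m where "n = Suc m"
    by (cases n) auto
  then have "- x = nat_mult m x"
    using n by (simp add: minus_unique)
  then show ?thesis
    using subgroup_character_nat_mult[OF assms] by simp
qed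

lemma subgroup_character_diff:
  fixes x :: "'g::{finite,ab_group_add}"
  assumes "subgroup_character H \<phi>" "x \<in> H" "y \<in> H"
  shows "x - y \<in> H"
  using assms subgroup_character_minus[OF assms(1,3)]
  unfolding subgroup_character_def by (metis diff_conv_add_uminus)

text \<open>Here \<open>n\<close> is the order of \<open>x\<close> modulo \<open>H\<close>. Sending
  \<open>x\<close> to \<open>z\<close> is consistent with \<open>\<phi>\<close> precisely because
  \<open>z ^ n\<close> is the value already prescribed at the first multiple of \<open>x\<close> in
  \<open>H\<close>.\<close>

lemma subgroup_character_extend_one:
  fixes x :: "'g::{finite,ab_group_add}"
  assumes \<phi>: "subgroup_character H \<phi>"
    and n: "n > 0" "nat_mult n x \<in> H" "\<And>i. 0 < i \<Longrightarrow> i < n \<Longrightarrow> nat_mult i x \<notin> H"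
    and z: "z ^ n = \<phi> (nat_mult n x)"
  obtains H' \<phi>' where "subgroup_character H' \<phi>'" "H \<subseteq> H'" "x \<in> H'" "\<phi>' x = z"
    "\<And>h. h \<in> H \<Longrightarrow> \<phi>' h = \<phi> h"
proof -
  have H: "0 \<in> H" "\<And>x y. x \<in> H \<Longrightarrow> y \<in> H \<Longrightarrow> x + y \<in> H" "\<phi> 0 = 1"
    "\<And>x y. x \<in> H \<Longrightarrow> y \<in> H \<Longrightarrow> \<phi> (x + y) = \<phi> x * \<phi> y"
    using \<phi> by (auto simp: subgroup_character_def)
  \<comment> \<open>Minimality of \<open>n\<close> forces the remainder of \<open>i\<close> modulo
    \<open>n\<close> to vanish, so the multiple is one of \<open>nat_mult n x\<close>.\<close>
  have pow: "\<phi> (nat_mult i x) = z ^ i" if i: "nat_mult i x \<in> H" for i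
  proof -
    define q r where "q = i div n" and "r = i mod n"
    have iqr: "i = r + q * n"
      by (simp add: q_def r_def)
    have "nat_mult r x = nat_mult i x - nat_mult q (nat_mult n x)"
      by (simp add: iqr nat_mult_add nat_mult_mult)
    then have "nat_mult r x \<in> H"
      using subgroup_character_diff[OF \<phi> i] subgroup_character_nat_mult[OF \<phi> n(2)] by simp
    then have "r = 0"
      using n(1) n(3)[of r] by (auto simp: r_def)
    then have "\<phi> (nat_mult i x) = \<phi> (nat_mult n x) ^ q"
      using subgroup_character_nat_mult[OF \<phi> n(2)] by (simp add: iqr nat_mult_mult)
    then show ?thesis
      using \<open>r = 0\<close> z by (metis add_0 iqr mult.commute power_mult)
  qed
  have well_le: "\<phi> (y - nat_mult i x) * z ^ i = \<phi> (y - nat_mult j x) * z ^ j"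
    if "i \<le> j" "y - nat_mult i x \<in> H" "y - nat_mult j x \<in> H" for y i j
  proof -
    obtain l where j: "j = i + l"
      using \<open>i \<le> j\<close> le_Suc_ex by blast
    have eq: "y - nat_mult i x = (y - nat_mult j x) + nat_mult l x"
      by (simp add: j nat_mult_add)
    have "nat_mult l x = (y - nat_mult i x) - (y - nat_mult j x)"
      by (simp add: j nat_mult_add)
    then have l: "nat_mult l x \<in> H"
      using subgroup_character_diff[OF \<phi> that(2,3)] by simp
    show ?thesis
      unfolding eq using H(4)[OF that(3) l] pow[OF l] by (simp add: j power_add)
  qed
  have well: "\<phi> (y - nat_mult i x) * z ^ i = \<phi> (y - nat_mult j x) * z ^ j"
    if "y - nat_mult i x \<in> H" "y - nat_mult j x \<in> H" for y i j
    using well_le[OF _ that] well_le[OF _ that(2,1), symmetric] linear[of i j] by blast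
  \<comment> \<open>\<open>H'\<close> is the subgroup generated by \<open>H\<close> and
    \<open>x\<close>; natural multiples suffice as \<open>x\<close> has finite order. By
    \<open>well\<close> the choice of \<open>i\<close> in \<open>\<phi>'\<close> is
    immaterial.\<close>
  define H' where "H' = {y. \<exists>i. y - nat_mult i x \<in> H}"
  define \<phi>' where "\<phi>' y = (let i = SOME i. y - nat_mult i x \<in> H in \<phi> (y - nat_mult i x) * z ^ i)" for y
  have \<phi>': "\<phi>' y = \<phi> (y - nat_mult i x) * z ^ i" if "y - nat_mult i x \<in> H" for y i
    unfolding \<phi>'_def Let_def using that by (intro well) (rule someI)
  have HH': "h \<in> H'" "\<phi>' h = \<phi> h" if "h \<in> H" for h
    using that \<phi>'[of h 0] by (auto simp: H'_def intro: exI[of _ 0])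
  show ?thesis
  proof (rule that[of H' \<phi>'])
    have "u + v \<in> H' \<and> \<phi>' (u + v) = \<phi>' u * \<phi>' v" if uv: "u \<in> H'" "v \<in> H'" for u v
    proof -
      obtain i j where ij: "u - nat_mult i x \<in> H" "v - nat_mult j x \<in> H"
        using uv by (auto simp: H'_def)
      have eq: "u + v - nat_mult (i + j) x = (u - nat_mult i x) + (v - nat_mult j x)"
        by (simp add: nat_mult_add algebra_simps)
      have m: "u + v - nat_mult (i + j) x \<in> H"
        unfolding eq by (rule H(2)[OF ij])
      have "\<phi>' (u + v) = \<phi> ((u - nat_mult i x) + (v - nat_mult j x)) * z ^ (i + j)"
        using \<phi>'[OF m] unfolding eq .
      then show ?thesis
        using m ij H(4)[OF ij] \<phi>' by (auto simp: H'_def power_add)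
    qed
    then show "subgroup_character H' \<phi>'"
      using HH'[OF H(1)] H(3) by (simp add: subgroup_character_def)
    show "x \<in> H'" "\<phi>' x = z"
      using H \<phi>'[of x 1] by (auto simp: H'_def intro: exI[of _ 1])
  qed (use HH' in auto)
qed

lemma least_multiple_in_subgroup:
  fixes x :: "'g::{finite,ab_group_add}"
  assumes "0 \<in> H"
  obtains n where "n > 0" "nat_mult n x \<in> H" "\<And>i. 0 < i \<Longrightarrow> i < n \<Longrightarrow> nat_mult i x \<notin> H"
proof -
  let ?P = "\<lambda>n. 0 < n \<and> nat_mult n x \<in> H"
  have "\<exists>n. ?P n"
    using assms finite_order_element by metis
  then have "?P (LEAST n. ?P n)"
    by (rule LeastI_ex)
  moreover have "\<not> ?P i" if "i < (LEAST n. ?P n)" for i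
    using that by (rule not_less_Least)
  ultimately show ?thesis
    using that by blast
qed

lemma complex_root_exists:
  fixes c :: complex
  assumes "n > 0"
  obtains z where "z ^ n = c"
proof (cases "c = 0")
  case True
  then show ?thesis using that[of 0] assms by simp
next
  case False
  have "exp (Ln c / of_nat n) ^ n = c"
    using assms False by (simp flip: exp_of_nat_mult)
  then show ?thesis by (rule that)
qed

text \<open>Induction on the number of elements outside \<open>H\<close>. Each step adjoins one
  element, and the value it needs exists because complex numbers have roots of every positive
  order.\<close>

lemma subgroup_character_extend:
  fixes H :: "'g::{finite,ab_group_add} set"
  assumes "subgroup_character H \<phi>"
  shows "\<exists>\<phi>'. subgroup_character UNIV \<phi>' \<and> (\<forall>h\<in>H. \<phi>' h = \<phi> h)"
  using assms
proof (induction "card (UNIV - H)" arbitrary: H \<phi> rule: less_induct)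
  case less
  show ?case
  proof (cases "H = UNIV")
    case True
    then show ?thesis using less.prems by blast
  next
    case False
    then obtain x where x: "x \<notin> H" by blast
    have "0 \<in> H"
      using less.prems by (simp add: subgroup_character_def)
    then obtain n where n: "n > 0" "nat_mult n x \<in> H"
      "\<And>i. 0 < i \<Longrightarrow> i < n \<Longrightarrow> nat_mult i x \<notin> H"
      by (rule least_multiple_in_subgroup[where x = x]) blast
    obtain z where "z ^ n = \<phi> (nat_mult n x)"
      using complex_root_exists[OF n(1)] .
    then obtain H' \<phi>' where H': "subgroup_character H' \<phi>'" "H \<subseteq> H'" "x \<in> H'"
      "\<And>h. h \<in> H \<Longrightarrow> \<phi>' h = \<phi> h"
      using subgroup_character_extend_one[OF less.prems n] by metis
    have "card (UNIV - H') < card (UNIV - H)"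
      using H' x by (intro psubset_card_mono) auto
    from less.hyps[OF this H'(1)] show ?thesis
      using H' by (metis subsetD)
  qed
qed

text \<open>On the cyclic group generated by \<open>g\<close>, of order \<open>n > 1\<close>, the
  generator is sent to a primitive \<open>n\<close>-th root of unity; this character is then
  extended to the whole group.\<close>

lemma character_separates:
  fixes g :: "'g::{finite,ab_group_add}"
  assumes "g \<noteq> 0"
  obtains \<phi> :: "'g \<Rightarrow> complex" where "\<And>x y. \<phi> (x + y) = \<phi> x * \<phi> y" "\<phi> 0 = 1" "\<phi> g \<noteq> 1"
proof -
  have triv: "subgroup_character {0::'g} (\<lambda>_. 1)"
    by (simp add: subgroup_character_def)
  obtain n where n: "n > 0" "nat_mult n g \<in> {0}"
    "\<And>i. 0 < i \<Longrightarrow> i < n \<Longrightarrow> nat_mult i g \<notin> {0}"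
    by (rule least_multiple_in_subgroup[where x = g and H = "{0}"]) auto
  have "n \<noteq> 1"
    using n(2) assms by auto
  define z where "z = cis (2 * pi / real n)"
  have "z ^ n = 1"
    using n(1) by (simp add: z_def Complex.DeMoivre)
  have "z \<noteq> 1"
  proof
    assume "z = 1"
    then have "cis (2 * pi * real 1 / real n) = cis (2 * pi * real 0 / real n)"
      by (simp add: z_def)
    moreover have "inj_on (\<lambda>k. cis (2 * pi * real k / real n)) {..<n}"
      using Complex.bij_betw_roots_unity[OF n(1)] by (simp add: bij_betw_def)
    ultimately show False
      using n(1) \<open>n \<noteq> 1\<close> by (auto dest: inj_onD[where x = 1 and y = 0])
  qed
  obtain H' \<phi>' where H': "subgroup_character H' \<phi>'" "g \<in> H'" "\<phi>' g = z"
    using subgroup_character_extend_one[OF triv n] \<open>z ^ n = 1\<close> by metis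
  from subgroup_character_extend[OF H'(1)] obtain \<phi>
    where "subgroup_character UNIV \<phi>" "\<phi> g = z"
    using H' by auto
  then show ?thesis
    using that \<open>z \<noteq> 1\<close> by (auto simp: subgroup_character_def)
qed

lemma character_exponent:
  fixes \<phi> :: "'g::{finite,ab_group_add} \<Rightarrow> complex"
  assumes "\<And>x y. \<phi> (x + y) = \<phi> x * \<phi> y" "\<phi> 0 = 1"
  obtains m where "m > 0" "\<And>x. \<phi> x ^ m = 1"
proof -
  have \<phi>: "subgroup_character UNIV \<phi>"
    using assms by (simp add: subgroup_character_def)
  have "\<forall>x. \<exists>n>0. nat_mult n x = (0::'g)"
    using finite_order_element by metis
  then obtain ord where o: "\<And>x::'g. ord x > 0" "\<And>x. nat_mult (ord x) x = 0"
    by metis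
  define m where "m = (\<Prod>x\<in>UNIV. ord x)"
  have "m > 0"
    unfolding m_def by (rule prod_pos) (use o in auto)
  moreover have "\<phi> x ^ m = 1" for x
  proof -
    have "ord x dvd m"
      unfolding m_def by (rule dvd_prodI) auto
    moreover have "\<phi> x ^ ord x = 1"
      using subgroup_character_nat_mult[OF \<phi>, of x "ord x"] o assms by simp
    ultimately show ?thesis
      by (metis dvdE power_mult power_one)
  qed
  ultimately show ?thesis by (rule that)
qed

section \<open>Graded complex Banach algebras\<close>

context
  fixes smul :: "complex \<Rightarrow> 'a::{real_normed_algebra_1,banach} \<Rightarrow> 'a"
  assumes smul: "complex_scaling smul"
begin

lemma smul_add_right: "smul c (x + y) = smul c x + smul c y"
  and smul_add_left: "smul (c + d) x = smul c x + smul d x"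
  and smul_smul: "smul c (smul d x) = smul (c * d) x"
  and smul_of_real: "smul (complex_of_real r) x = r *\<^sub>R x"
  and smul_mult_left: "smul c x * y = smul c (x * y)"
  and smul_mult_right: "x * smul c y = smul c (x * y)"
  using smul unfolding complex_scaling_def by metis+

lemma smul_0_left [simp]: "smul 0 x = 0" and smul_1 [simp]: "smul 1 x = x"
  using smul_of_real[of 0 x] smul_of_real[of 1 x] by auto

lemma smul_0_right [simp]: "smul c 0 = 0"
  using smul_add_right[of c 0 0] by simp

lemma smul_sum_left: "smul (\<Sum>i\<in>I. f i) x = (\<Sum>i\<in>I. smul (f i) x)"
  by (induction I rule: infinite_finite_induct) (auto simp: smul_add_left)

lemma smul_sum_right: "smul c (\<Sum>i\<in>I. f i) = (\<Sum>i\<in>I. smul c (f i))"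
  by (induction I rule: infinite_finite_induct) (auto simp: smul_add_right)

lemma smul_diff_left: "smul (c - d) x = smul c x - smul d x"
  using smul_add_left[of "c - d" d x] by simp

lemma smul_eq_0_iff: "smul c x = 0 \<longleftrightarrow> c = 0 \<or> x = 0"
proof
  assume "smul c x = 0"
  moreover have "norm (smul c x) = cmod c * norm x"
    using smul unfolding complex_scaling_def by blast
  ultimately show "c = 0 \<or> x = 0"
    by simp
qed auto

lemma smul_cancel_right: "smul c x = smul d x \<longleftrightarrow> c = d \<or> x = 0"
  using smul_eq_0_iff[of "c - d" x] by (simp add: smul_diff_left)

lemma smul_power: "smul c x ^ n = smul (c ^ n) (x ^ n)"
  by (induction n) (simp_all add: smul_mult_left smul_mult_right smul_smul mult.commute)

lemma invertible_el_smul: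
  assumes "c \<noteq> 0" "invertible_el x"
  shows "invertible_el (smul c x)"
proof -
  obtain y where "x * y = 1" "y * x = 1"
    using assms unfolding invertible_el_def by blast
  then have "smul c x * smul (1 / c) y = 1" "smul (1 / c) y * smul c x = 1"
    using assms by (simp_all add: smul_mult_left smul_mult_right smul_smul)
  then show ?thesis
    unfolding invertible_el_def by blast
qed

text \<open>The spectral projections of \<open>u\<close> are the discrete Fourier coefficients of
  \<open>j \<mapsto> u ^ j\<close>; they sum to 1, so one of them is nonzero and therefore equal to 1.\<close>

lemma root_of_one_scalar:
  fixes u :: 'a
  assumes idem: "no_nontrivial_idempotent TYPE('a)" and n: "n > 0" and u: "u ^ n = 1"
  obtains c where "u = smul c 1"
proof -
  define w where "w j = cis (2 * pi * real j / real n)" for j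
  have wn: "w j ^ n = 1" for j
    using n cis_multiple_2pi[of "real j"] by (simp add: w_def Complex.DeMoivre)
  \<comment> \<open>The exponent \<open>n - i\<close> stands for \<open>- i\<close>, since
    \<open>w j ^ n = 1\<close>. The element \<open>p j\<close> is the projection belonging to the
    eigenvalue \<open>w j\<close> of \<open>u\<close>.\<close>
  define p where "p j = smul (1 / of_nat n) (\<Sum>i<n. smul (w j ^ (n - i)) (u ^ i))" for j
  have up: "u * p j = smul (w j) (p j)" for j
  proof -
    define f where "f i = smul (w j ^ (n + 1 - i)) (u ^ i)" for i
    \<comment> \<open>Multiplication by \<open>u\<close> shifts the summation index; the boundary
      terms \<open>f 0\<close> and \<open>f n\<close> agree, so the shift is cyclic.\<close>
    have "(\<Sum>i<n. f (Suc i)) + f 0 = (\<Sum>i<n. f i) + f n"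
      by (metis sum.lessThan_Suc sum.lessThan_Suc_shift add.commute)
    moreover have "f 0 = f n"
      by (simp add: f_def wn u)
    ultimately have shift: "(\<Sum>i<n. f (Suc i)) = (\<Sum>i<n. f i)"
      by simp
    have "u * p j = smul (1 / of_nat n) (\<Sum>i<n. f (Suc i))"
      by (simp add: p_def f_def smul_mult_right sum_distrib_left)
    also have "\<dots> = smul (1 / of_nat n) (\<Sum>i<n. smul (w j) (smul (w j ^ (n - i)) (u ^ i)))"
      unfolding shift unfolding f_def
      by (intro arg_cong[where f = "smul _"] sum.cong) (auto simp: smul_smul Suc_diff_le)
    also have "\<dots> = smul (w j) (p j)"
      unfolding p_def smul_sum_right[symmetric] by (simp add: smul_smul)
    finally show ?thesis .
  qed
  have pp: "p j * p j = p j" for j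
  proof -
    have upow: "u ^ i * p j = smul (w j ^ i) (p j)" for i
      by (induction i) (simp_all add: mult.assoc up smul_mult_right smul_smul mult.commute)
    have "p j * p j = smul (1 / of_nat n) (\<Sum>i<n. smul (w j ^ (n - i)) (u ^ i * p j))"
      by (simp add: smul_mult_left sum_distrib_right p_def[of j])
    also have "(\<Sum>i<n. smul (w j ^ (n - i)) (u ^ i * p j)) = (\<Sum>i<n. p j)"
      by (intro sum.cong) (auto simp: upow smul_smul wn simp flip: power_add)
    also have "\<dots> = smul (of_nat n) (p j)"
      using smul_sum_left[of "\<lambda>_. 1" "{..<n}" "p j"] by simp
    finally show ?thesis
      using n by (simp add: smul_smul)
  qed
  have "(\<Sum>j<n. p j) = 1"
  proof -
    \<comment> \<open>Orthogonality of roots of unity: for \<open>i \<noteq> 0\<close> this is a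
      full geometric sum with ratio different from 1.\<close>
    have w_sum: "(\<Sum>j<n. w j ^ (n - i)) = (if i = 0 then of_nat n else 0)" if "i < n" for i
    proof (cases "i = 0")
      case True
      then show ?thesis by (simp add: wn)
    next
      case False
      define z where "z = w (n - i)"
      have "w j ^ (n - i) = z ^ j" for j
        by (simp add: w_def z_def Complex.DeMoivre mult_ac)
      moreover have "z \<noteq> 1"
      proof
        assume "z = 1"
        then have "w (n - i) = w 0"
          by (simp add: z_def w_def)
        moreover have "inj_on w {..<n}"
          using Complex.bij_betw_roots_unity[OF n] unfolding w_def by (simp add: bij_betw_def)
        ultimately show False
          using inj_onD[of w "{..<n}" "n - i" 0] n False that by auto
      qed
      moreover have "z ^ n = 1"
        by (simp add: z_def wn)
      ultimately show ?thesis
        using False by (simp add: geometric_sum)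
    qed
    have "(\<Sum>j<n. p j) = smul (1 / of_nat n) (\<Sum>i<n. \<Sum>j<n. smul (w j ^ (n - i)) (u ^ i))"
      unfolding p_def smul_sum_right[symmetric] by (subst sum.swap) simp
    also have "(\<Sum>i<n. \<Sum>j<n. smul (w j ^ (n - i)) (u ^ i)) = (\<Sum>i<n. if i = 0 then smul (of_nat n) 1 else 0)"
      by (intro sum.cong) (auto simp: w_sum simp flip: smul_sum_left)
    finally show ?thesis
      using n by (simp add: smul_smul)
  qed
  then obtain j where "p j \<noteq> 0"
    by (metis sum.neutral zero_neq_one)
  then have "p j = 1"
    using idem pp unfolding no_nontrivial_idempotent_def by blast
  then show ?thesis
    using that[of "w j"] up[of j] by simp
qed

lemma root_of_scalar_scalar:
  fixes u :: 'a
  assumes idem: "no_nontrivial_idempotent TYPE('a)" and n: "n > 0"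
    and u: "u ^ n = smul c 1" "c \<noteq> 0"
  obtains r where "u = smul r 1" "r ^ n = c"
proof -
  obtain s where s: "s ^ n = c"
    using complex_root_exists[OF n] .
  then have "s \<noteq> 0"
    using u n by auto
  have "smul (1 / s) u ^ n = 1"
    using u s \<open>s \<noteq> 0\<close> by (simp add: smul_power smul_smul power_divide)
  then obtain t where "smul (1 / s) u = smul t 1"
    using root_of_one_scalar[OF idem n] by blast
  then have "smul s (smul (1 / s) u) = smul (s * t) 1"
    by (simp add: smul_smul)
  then have *: "u = smul (s * t) 1"
    using \<open>s \<noteq> 0\<close> by (simp add: smul_smul)
  then have "smul ((s * t) ^ n) 1 = smul c 1"
    using u by (simp add: smul_power)
  then show ?thesis
    using that[OF *] by (simp add: smul_cancel_right)
qed

text \<open>The quotient of \<open>x\<close> by \<open>d\<close> is an \<open>n\<close>-th root of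
  the scalar \<open>c\<close>, hence itself a scalar.\<close>

lemma equal_power_imp_scalar_multiple:
  fixes x d :: 'a
  assumes idem: "no_nontrivial_idempotent TYPE('a)" and n: "n > 0"
    and comm: "x * d = d * x" and "invertible_el d" and pow: "x ^ n = smul c (d ^ n)" and "c \<noteq> 0"
  obtains r where "x = smul r d" "r ^ n = c"
proof -
  obtain i where i: "d * i = 1" "i * d = 1"
    using \<open>invertible_el d\<close> unfolding invertible_el_def by blast
  have "i * x = x * i"
    using commute_inverse[OF i] comm by simp
  then have "(x * i) ^ n = smul c (d ^ n * i ^ n)"
    by (simp add: power_mult_distrib_commute pow smul_mult_left)
  also have "d ^ n * i ^ n = (d * i) ^ n"
    using i by (intro power_mult_distrib_commute[symmetric]) simp
  finally have "(x * i) ^ n = smul c 1"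
    by (simp add: i)
  then obtain r where r: "x * i = smul r 1" "r ^ n = c"
    using root_of_scalar_scalar[OF idem n] \<open>c \<noteq> 0\<close> by blast
  have "x = (x * i) * d"
    by (simp add: mult.assoc i)
  then show ?thesis
    using that r by (simp add: smul_mult_left)
qed

section \<open>The automorphism of a graded algebra induced by a character\<close>

context
  fixes Ag :: "'g::{finite,ab_group_add} \<Rightarrow> 'a set"
  assumes graded: "graded smul Ag"
begin

definition homog_part :: "'a \<Rightarrow> 'g \<Rightarrow> 'a" where
  "homog_part x = (THE f. (\<forall>g. f g \<in> Ag g) \<and> x = (\<Sum>g\<in>UNIV. f g))"

lemma homog_part_in: "homog_part x g \<in> Ag g"
  and sum_homog_part: "(\<Sum>g\<in>UNIV. homog_part x g) = x"
proof -
  have "\<exists>!f. (\<forall>g. f g \<in> Ag g) \<and> x = (\<Sum>g\<in>UNIV. f g)"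
    using graded unfolding graded_def by blast
  from theI'[OF this] show "homog_part x g \<in> Ag g" "(\<Sum>g\<in>UNIV. homog_part x g) = x"
    unfolding homog_part_def by auto
qed

lemma homog_part_eq:
  assumes "\<And>g. f g \<in> Ag g"
  shows "homog_part (\<Sum>g\<in>UNIV. f g) = f"
proof -
  have "\<exists>!h. (\<forall>g. h g \<in> Ag g) \<and> (\<Sum>g\<in>UNIV. f g) = (\<Sum>g\<in>UNIV. h g)"
    using graded unfolding graded_def by blast
  then show ?thesis
    using assms homog_part_in sum_homog_part by metis
qed

definition twist :: "('g \<Rightarrow> complex) \<Rightarrow> 'a \<Rightarrow> 'a" where
  "twist \<phi> x = (\<Sum>g\<in>UNIV. smul (\<phi> g) (homog_part x g))"

lemma twist_sum_homogeneous:
  assumes "\<And>g. f g \<in> Ag g"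
  shows "twist \<phi> (\<Sum>g\<in>UNIV. f g) = (\<Sum>g\<in>UNIV. smul (\<phi> g) (f g))"
  unfolding twist_def by (simp add: homog_part_eq assms)

lemma twist_homogeneous:
  assumes "x \<in> Ag g"
  shows "twist \<phi> x = smul (\<phi> g) x"
proof -
  have "0 \<in> Ag h" for h
    using graded unfolding graded_def by blast
  then have "twist \<phi> (\<Sum>h\<in>UNIV. if h = g then x else 0)
      = (\<Sum>h\<in>UNIV. smul (\<phi> h) (if h = g then x else 0))"
    using assms by (intro twist_sum_homogeneous) auto
  also have "\<dots> = (\<Sum>h\<in>UNIV. if h = g then smul (\<phi> h) x else 0)"
    by (intro sum.cong) auto
  finally show ?thesis
    by simp
qed

lemma twist_add: "twist \<phi> (x + y) = twist \<phi> x + twist \<phi> y"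
proof -
  have "homog_part x g + homog_part y g \<in> Ag g" for g
    using homog_part_in graded unfolding graded_def by blast
  then have "twist \<phi> (\<Sum>g\<in>UNIV. homog_part x g + homog_part y g)
      = (\<Sum>g\<in>UNIV. smul (\<phi> g) (homog_part x g + homog_part y g))"
    by (rule twist_sum_homogeneous)
  then show ?thesis
    by (simp add: sum.distrib sum_homog_part smul_add_right twist_def)
qed

lemma twist_smul: "twist \<phi> (smul c x) = smul c (twist \<phi> x)"
proof -
  have "smul c (homog_part x g) \<in> Ag g" for g
    using homog_part_in graded unfolding graded_def by blast
  then have "twist \<phi> (\<Sum>g\<in>UNIV. smul c (homog_part x g))
      = (\<Sum>g\<in>UNIV. smul (\<phi> g) (smul c (homog_part x g)))"
    by (rule twist_sum_homogeneous)
  then show ?thesis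
    by (simp add: sum_homog_part smul_smul mult.commute twist_def flip: smul_sum_right)
       (simp add: smul_sum_right smul_smul mult.commute)
qed

lemma twist_sum: "twist \<phi> (\<Sum>i\<in>I. f i) = (\<Sum>i\<in>I. twist \<phi> (f i))"
proof -
  have "twist \<phi> 0 = 0"
    using twist_add[of \<phi> 0 0] by simp
  then show ?thesis
    by (induction I rule: infinite_finite_induct) (auto simp: twist_add)
qed

text \<open>Expansion into homogeneous parts reduces the claim to a product of parts of degrees
  \<open>g\<close> and \<open>h\<close>, which has degree \<open>g + h\<close>.\<close>

lemma twist_mult:
  fixes \<phi> :: "'g \<Rightarrow> complex"
  assumes "\<And>g h. \<phi> (g + h) = \<phi> g * \<phi> h"
  shows "twist \<phi> (x * y) = twist \<phi> x * twist \<phi> y"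
proof -
  have "homog_part x g * homog_part y h \<in> Ag (g + h)" for g h
    using homog_part_in graded unfolding graded_def by blast
  then have "twist \<phi> (homog_part x g * homog_part y h)
      = smul (\<phi> (g + h)) (homog_part x g * homog_part y h)" for g h
    by (rule twist_homogeneous)
  then have hom: "twist \<phi> (homog_part x g * homog_part y h)
      = smul (\<phi> g) (homog_part x g) * smul (\<phi> h) (homog_part y h)" for g h
    by (simp add: assms smul_mult_left smul_mult_right smul_smul mult.commute)
  have "x * y = (\<Sum>g\<in>UNIV. \<Sum>h\<in>UNIV. homog_part x g * homog_part y h)"
    by (simp add: sum_homog_part flip: sum_product)
  then show ?thesis
    by (simp add: twist_sum hom) (simp add: twist_def sum_product)
qed

lemma twist_power:
  assumes "\<And>g h. \<phi> (g + h) = \<phi> g * \<phi> h" and "n > 0"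
  shows "twist \<phi> (x ^ n) = twist \<phi> x ^ n"
  using \<open>n > 0\<close> by (induction n rule: nat_induct_non_zero) (simp_all add: twist_mult assms)

lemma twist_funpow: "(twist \<phi> ^^ n) x = twist (\<lambda>g. \<phi> g ^ n) x"
proof (induction n)
  case 0
  show ?case by (simp add: twist_def sum_homog_part)
next
  case (Suc n)
  have "smul (\<phi> g ^ n) (homog_part x g) \<in> Ag g" for g
    using homog_part_in graded unfolding graded_def by blast
  then have "twist \<phi> (twist (\<lambda>g. \<phi> g ^ n) x)
      = (\<Sum>g\<in>UNIV. smul (\<phi> g) (smul (\<phi> g ^ n) (homog_part x g)))"
    unfolding twist_def[of "\<lambda>g. \<phi> g ^ n"] by (rule twist_sum_homogeneous)
  then show ?case
    by (simp add: Suc smul_smul twist_def[of "\<lambda>g. \<phi> g * \<phi> g ^ n"])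
qed

lemma twist_eigenvalue_power:
  fixes \<phi> :: "'g \<Rightarrow> complex"
  assumes "\<And>g. \<phi> g ^ m = 1" "twist \<phi> d = smul c d" "d \<noteq> 0"
  shows "c ^ m = 1"
proof -
  have "(twist \<phi> ^^ n) d = smul (c ^ n) d" for n
    by (induction n) (simp_all add: twist_smul assms(2) smul_smul mult.commute)
  moreover have "(twist \<phi> ^^ m) d = d"
    unfolding twist_funpow assms(1) by (simp add: twist_def sum_homog_part)
  ultimately have "smul (c ^ m) d = smul 1 d"
    by simp
  then show ?thesis
    using assms(3) unfolding smul_cancel_right by simp
qed

lemma homogeneous_power_no_root:
  fixes \<phi> :: "'g \<Rightarrow> complex"
  assumes idem: "no_nontrivial_idempotent TYPE('a)"
    and \<phi>: "\<And>g h. \<phi> (g + h) = \<phi> g * \<phi> h" "\<And>g. \<phi> g ^ m = 1" "\<phi> g \<noteq> 1"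
    and pos: "m > 0" "k > 0"
    and a: "a \<in> Ag g" "invertible_el a"
    and d: "d ^ (k * m) = a ^ k"
    and comm: "\<And>z. z * a ^ k = a ^ k * z \<Longrightarrow> z * d = d * z"
  shows False
proof -
  have ad: "a * d = d * a"
    by (rule comm) (simp add: power_commutes)
  have "invertible_el (d ^ (k * m))"
    using d a pos by (simp add: invertible_el_power_iff)
  then have inv_d: "invertible_el d"
    using pos by (simp add: invertible_el_power_iff)
  then have "d \<noteq> 0"
    by (auto simp: invertible_el_def)
  have "\<phi> g \<noteq> 0"
    using \<phi>(2)[of g] pos by (auto simp: power_0_left)
  have "a * d ^ m = d ^ m * a"
    by (metis ad power_commuting_commutes)
  \<comment> \<open>The commuting elements \<open>a\<close> and \<open>d ^ m\<close> have the same
    \<open>k\<close>-th power, so they differ by a scalar \<open>r\<close>.\<close>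
  moreover have "a ^ k = smul 1 ((d ^ m) ^ k)"
    using d by (simp add: mult.commute flip: power_mult)
  ultimately obtain r where r: "a = smul r (d ^ m)"
    using equal_power_imp_scalar_multiple[OF idem pos(2)] inv_d pos
    by (metis invertible_el_power_iff zero_neq_one)
  have "r \<noteq> 0"
    using r a by (auto simp: invertible_el_def)
  have "smul r (twist \<phi> d ^ m) = twist \<phi> a"
    by (simp add: r twist_smul twist_power[OF \<phi>(1)] pos)
  also have "\<dots> = smul r (smul (\<phi> g) (d ^ m))"
    unfolding twist_homogeneous[OF a(1)] by (simp add: r smul_smul mult.commute)
  finally have "smul (1 / r) (smul r (twist \<phi> d ^ m))
      = smul (1 / r) (smul r (smul (\<phi> g) (d ^ m)))"
    by simp
  then have pow: "twist \<phi> d ^ m = smul (\<phi> g) (d ^ m)"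
    using \<open>r \<noteq> 0\<close> by (simp add: smul_smul)
  \<comment> \<open>Applying the twist to \<open>d * a ^ k = a ^ k * d\<close> only rescales
    \<open>a ^ k\<close> by a nonzero scalar. So \<open>twist \<phi> d\<close> commutes with
    \<open>a ^ k\<close>, and by \<open>comm\<close> also with \<open>d\<close>.\<close>
  have "twist \<phi> d * d = d * twist \<phi> d"
  proof (rule comm)
    have tak: "twist \<phi> (a ^ k) = smul (\<phi> g ^ k) (a ^ k)"
      by (simp add: twist_power[OF \<phi>(1)] pos twist_homogeneous[OF a(1)] smul_power)
    have "d * a ^ k = a ^ k * d"
      by (simp add: power_commutes flip: d)
    then have "twist \<phi> d * twist \<phi> (a ^ k) = twist \<phi> (a ^ k) * twist \<phi> d"
      by (metis twist_mult[OF \<phi>(1)])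
    then have "smul (1 / \<phi> g ^ k) (smul (\<phi> g ^ k) (twist \<phi> d * a ^ k))
        = smul (1 / \<phi> g ^ k) (smul (\<phi> g ^ k) (a ^ k * twist \<phi> d))"
      by (simp add: tak smul_mult_left smul_mult_right)
    then show "twist \<phi> d * a ^ k = a ^ k * twist \<phi> d"
      using \<open>\<phi> g \<noteq> 0\<close> by (simp add: smul_smul)
  qed
  then obtain c where c: "twist \<phi> d = smul c d" "c ^ m = \<phi> g"
    using equal_power_imp_scalar_multiple[OF idem pos(1) _ inv_d pow \<open>\<phi> g \<noteq> 0\<close>] by blast
  then have "c ^ m = 1"
    using twist_eigenvalue_power[of \<phi> m d c] \<phi>(2) \<open>d \<noteq> 0\<close> by blast
  then show False
    using c \<phi>(3) by simp
qed

end

text \<open>If 0 is outside the convex hull of the spectrum of \<open>x\<close>, then a line through 0 weakly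
  separates them, so the segment from a suitable scalar to \<open>x\<close> consists of invertibles.\<close>

lemma commuting_root_of_hull:
  fixes x :: 'a
  assumes hull: "0 \<notin> convex hull (spec smul x)" and "N > 0"
  shows "commuting_root N {z. z * x = x * z} x"
proof -
  obtain v where v: "v \<noteq> 0" "\<forall>c\<in>convex hull (spec smul x). 0 \<le> v \<bullet> c"
    using separating_hyperplane_set_0[OF convex_convex_hull hull] by blast
  \<comment> \<open>On the ray from 0 opposite to \<open>v\<close> the functional is nonpositive, so
    this ray could meet the hull only at 0, which is excluded.\<close>
  have inv: "invertible_el (x - smul (- (of_real s * v)) 1)" if "s \<ge> 0" for s :: real
  proof (rule ccontr)
    assume "\<not> ?thesis"
    then have mem: "- (of_real s * v) \<in> convex hull (spec smul x)"
      by (intro hull_inc) (simp add: spec_def)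
    then have "0 \<le> v \<bullet> (- (s *\<^sub>R v))"
      using v(2) unfolding scaleR_conv_of_real by blast
    then have "s * (v \<bullet> v) \<le> 0"
      by simp
    moreover have "v \<bullet> v > 0"
      using v(1) by (simp only: inner_gt_zero_iff) simp
    ultimately have "s = 0"
      using that by (auto simp: mult_le_0_iff)
    then show False
      using mem hull by simp
  qed
  define f where "f t = t *\<^sub>R x + (1 - t) *\<^sub>R smul v 1" for t :: real
  define C where "C = f ` {0..1}"
  have central: "z * smul v 1 = smul v 1 * z" for z
    by (simp add: smul_mult_left smul_mult_right)
  have f_comm: "z * f t = f t * z" if "z * x = x * z" for z t
    using that central[of z] by (simp add: f_def algebra_simps)
  \<comment> \<open>The segment contains \<open>x = f 1\<close>, and its other points are
    combinations of \<open>x\<close> with a central element; both commutants therefore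
    agree.\<close>
  have W: "{z. z * x = x * z} = {z. \<forall>c\<in>C. z * c = c * z}"
    using f_comm by (auto simp: C_def f_def dest: bspec[where x = 1])
  show ?thesis
  proof (rule commuting_root_connected[OF _ _ _ \<open>N > 0\<close> _ _ W])
    show "connected C"
      unfolding C_def f_def
      by (intro connected_continuous_image continuous_intros connected_Icc)
    show "smul v 1 \<in> C" "x \<in> C"
      unfolding C_def f_def by (auto intro: image_eqI[of _ _ 0] image_eqI[of _ _ 1])
    show "c * c' = c' * c" if "c \<in> C" "c' \<in> C" for c c'
      using that f_comm unfolding C_def by (metis imageE)
    show "invertible_el c" if c: "c \<in> C" for c
    proof -
      obtain t where t: "c = f t" "0 \<le> t" "t \<le> 1"
        using c unfolding C_def by auto
      show ?thesis
      proof (cases "t = 0")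
        case True
        have "invertible_el (1::'a)"
          by (auto simp: invertible_el_def)
        then show ?thesis
          using True t v(1) by (simp add: f_def invertible_el_smul)
      next
        case False
        \<comment> \<open>For \<open>t > 0\<close> the point \<open>f t\<close> is \<open>t\<close>
          times \<open>x + s v\<close>, which is invertible by \<open>inv\<close>.\<close>
        define s where "s = (1 - t) / t"
        have "s \<ge> 0"
          using t by (simp add: s_def)
        have "smul (of_real t) (x - smul (- (of_real s * v)) 1)
            = t *\<^sub>R x + smul (of_real t * (of_real s * v)) 1"
          using smul_diff_left[of 0 "of_real s * v" 1]
          by (simp add: smul_add_right smul_smul) (simp add: smul_of_real)
        also have "of_real t * (of_real s * v) = of_real (1 - t) * v"
          using False by (simp add: s_def)
        also have "t *\<^sub>R x + smul (of_real (1 - t) * v) 1 = c"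
          unfolding t f_def smul_smul[symmetric] smul_of_real ..
        finally show ?thesis
          using invertible_el_smul[OF _ inv[OF \<open>s \<ge> 0\<close>], of "of_real t"] False by simp
      qed
    qed
    obtain r where "r ^ N = v"
      using complex_root_exists[OF \<open>N > 0\<close>] .
    then have "smul r 1 ^ N = smul v 1"
      by (simp add: smul_power)
    then show "commuting_root N {z. z * x = x * z} (smul v 1)"
      unfolding commuting_root_def
      by (intro exI[of _ "smul r 1"]) (auto simp: smul_mult_left smul_mult_right)
  qed
qed

end

text \<open>The component is a connected set of invertibles containing 1, and 1 is its own root of
  order \<open>N\<close>.\<close>

lemma commuting_root_of_component:
  fixes x :: "'a::{real_normed_algebra_1,banach}"
  assumes comm: "\<forall>x y::'a. x * y = y * x" and "N > 0"
    and x: "x \<in> connected_component_set {x. invertible_el x} 1"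
  shows "commuting_root N UNIV x"
proof (rule commuting_root_connected[OF _ _ _ \<open>N > 0\<close> _ x])
  show "connected (connected_component_set {x::'a. invertible_el x} 1)"
    by simp
  show "1 \<in> connected_component_set {x::'a. invertible_el x} 1"
    by (auto simp: invertible_el_def)
  show "invertible_el c" if "c \<in> connected_component_set {x::'a. invertible_el x} 1" for c
    using that connected_component_subset by blast
  show "commuting_root N UNIV (1::'a)"
    unfolding commuting_root_def by (intro exI[of _ 1]) auto
qed (use comm in auto)

theorem mainTheorem1:
  fixes smul :: "complex \<Rightarrow> 'a::{real_normed_algebra_1,banach} \<Rightarrow> 'a"
    and Ag :: "'g::{finite,ab_group_add} \<Rightarrow> 'a set"
    and a :: 'a and g :: 'g and k :: nat
  assumes "complex_scaling smul"
    and "graded smul Ag"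
    and "no_nontrivial_idempotent TYPE('a)"
    and "g \<noteq> 0"
    and "a \<in> Ag g"
    and "k > 0"
  shows "0 \<in> convex hull (spec smul (a ^ k)) \<and>
         ((\<forall>x y::'a. x * y = y * x) \<and> invertible_el a \<longrightarrow>
           a ^ k \<notin> connected_component_set {x. invertible_el x} 1)"
proof -
  obtain \<phi> :: "'g \<Rightarrow> complex"
    where \<phi>: "\<And>x y. \<phi> (x + y) = \<phi> x * \<phi> y" "\<phi> 0 = 1" "\<phi> g \<noteq> 1"
    using character_separates[OF \<open>g \<noteq> 0\<close>] by metis
  obtain m where m: "m > 0" "\<And>x. \<phi> x ^ m = 1"
    using character_exponent[OF \<phi>(1,2)] by metis
  have km: "k * m > 0"
    using \<open>k > 0\<close> m by simp
  have no_root: False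
    if "invertible_el a" "commuting_root (k * m) {z. z * a ^ k = a ^ k * z} (a ^ k)"
    using that homogeneous_power_no_root[OF assms(1-3) \<phi>(1) m(2) \<phi>(3) m(1) assms(6,5)]
    unfolding commuting_root_def by blast
  show ?thesis
  proof (intro conjI impI notI)
    show "0 \<in> convex hull (spec smul (a ^ k))"
    proof (rule ccontr)
      assume hull: "0 \<notin> convex hull (spec smul (a ^ k))"
      \<comment> \<open>Invertibility of \<open>a\<close>, which \<open>no_root\<close> requires,
        comes from 0 lying outside the spectrum of \<open>a ^ k\<close>.\<close>
      then have "0 \<notin> spec smul (a ^ k)"
        using hull_inc by metis
      then have "invertible_el a"
        using invertible_el_power_iff[OF \<open>k > 0\<close>, of a] smul_0_left[OF assms(1)]
        by (simp add: spec_def)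
      then show False
        using no_root commuting_root_of_hull[OF assms(1) hull km] by blast
    qed
  next
    assume "(\<forall>x y::'a. x * y = y * x) \<and> invertible_el a"
      and "a ^ k \<in> connected_component_set {x. invertible_el x} 1"
    then show False
      using no_root commuting_root_of_component[OF _ km, of "a ^ k"]
      unfolding commuting_root_def by blast
  qed
qed

end
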